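(* Let $X$ be a set, $E$ a nonempty set of parameters, $N\ge 1$ an integer, $(X,\mathcal{T}_i,N,E)$ a soft $N$-topological space over $X$ with soft topologies $\mathcal{T}_1,\dots,\mathcal{T}_N$, and let $Y$ be a nonempty subset of $X$. Then $(Y,\mathcal{T}_{i,Y},N,E)$, i.e. the set $Y$ equipped with the soft relative topologies $\mathcal{T}_{i,Y}$ of $\mathcal{T}_i$ on $Y$ ($i=1,\dots,N$), is a soft $N$-topological space over $Y$.
   Context: A soft set over a set $Z$ (with respect to the fixed nonempty parameter set $E$) is a pair $(F,E)$ where $F:E\to\mathcal{P}(Z)$ is any map. The null soft set has $F(e)=\emptyset$ for all $e$; the absolute soft set over $Z$ has $F(e)=Z$ for all $e$. Soft unions and soft intersections are defined parameterwise: the soft union of $\{(F_i,E)\}_{i\in I}$ is given by $e\mapsto\bigcup_i F_i(e)$ and the soft intersection of $(F,E)$ and $(G,E)$ by $e\mapsto F(e)\cap G(e)$. A soft topology on $Z$ with respect to $E$ is a family $\mathcal{T}$ of soft sets over $Z$ that contains the null soft set and the absolute soft set over $Z$, and is closed under soft intersections of two members and under arbitrary soft unions. A soft $N$-topological space $(Z,\mathcal{T}_i,N,E)$ over $Z$ is the set $Z$ equipped with $N$ different soft topologies $\mathcal{T}_1,\dots,\mathcal{T}_N$ on $Z$ with respect to the same $E$. For a nonempty $Y\subseteq X$ and a soft set $(F,E)$ over $X$, the sub soft set of $(F,E)$ over $Y$ is $({}^{Y}F,E)$ with ${}^{Y}F(e)=F(e)\cap Y$ for all $e\in E$. The soft relative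 topology on $Y$ of a soft topology $\mathcal{T}$ on $X$ is $\mathcal{T}_Y=\{({}^{Y}F,E) : (F,E)\in\mathcal{T}\}$; $\mathcal{T}_{i,Y}$ denotes the soft relative topology of $\mathcal{T}_i$ on $Y$.
   Formalization: The N soft topologies are not required to be pairwise different, neither on X nor on Y: with X={a,b}, one parameter, the indiscrete and discrete soft topologies and Y={a}, the two soft relative topologies coincide, so the literal claim with "different" fails. *)

theory Defs
  imports Main "HOL-Library.FuncSet"
begin

text \<open>A soft set over \<open>Z\<close> with parameter set \<open>E\<close> is a map from \<open>E\<close> to the subsets of \<open>Z\<close>.
  Maps on \<open>E\<close> are extensional functions (\<^const>\<open>undefined\<close> outside \<open>E\<close>), so that equality of
  soft sets is equality of maps on \<open>E\<close>.\<close>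

definition soft_sets :: "'z set \<Rightarrow> 'e set \<Rightarrow> ('e \<Rightarrow> 'z set) set" where
  "soft_sets Z E = E \<rightarrow>\<^sub>E Pow Z"

definition null_soft_set :: "'e set \<Rightarrow> 'e \<Rightarrow> 'z set" where
  "null_soft_set E = (\<lambda>e\<in>E. {})"

definition absolute_soft_set :: "'z set \<Rightarrow> 'e set \<Rightarrow> 'e \<Rightarrow> 'z set" where
  "absolute_soft_set Z E = (\<lambda>e\<in>E. Z)"

definition soft_Union :: "'e set \<Rightarrow> ('e \<Rightarrow> 'z set) set \<Rightarrow> 'e \<Rightarrow> 'z set" where
  "soft_Union E \<S> = (\<lambda>e\<in>E. \<Union>F\<in>\<S>. F e)"

definition soft_inter :: "'e set \<Rightarrow> ('e \<Rightarrow> 'z set) \<Rightarrow> ('e \<Rightarrow> 'z set) \<Rightarrow> 'e \<Rightarrow> 'z set" where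
  "soft_inter E F G = (\<lambda>e\<in>E. F e \<inter> G e)"

definition soft_topology :: "'z set \<Rightarrow> 'e set \<Rightarrow> ('e \<Rightarrow> 'z set) set \<Rightarrow> bool" where
  "soft_topology Z E \<T> \<longleftrightarrow>
     \<T> \<subseteq> soft_sets Z E \<and>
     null_soft_set E \<in> \<T> \<and>
     absolute_soft_set Z E \<in> \<T> \<and>
     (\<forall>F\<in>\<T>. \<forall>G\<in>\<T>. soft_inter E F G \<in> \<T>) \<and>
     (\<forall>\<S>. \<S> \<subseteq> \<T> \<longrightarrow> soft_Union E \<S> \<in> \<T>)"

text \<open>The \<open>N\<close> soft topologies form a family indexed by \<open>1, \<dots>, N\<close>; values of \<open>\<T>\<close> at other
  indices are irrelevant. The members are \<open>N\<close> individually given soft topologies and are not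
  required to be pairwise unequal: such a requirement is not inherited by subspaces (a one-point
  set with one parameter carries only one soft topology).\<close>

definition soft_N_topological_space ::
    "'z set \<Rightarrow> (nat \<Rightarrow> ('e \<Rightarrow> 'z set) set) \<Rightarrow> nat \<Rightarrow> 'e set \<Rightarrow> bool" where
  "soft_N_topological_space Z \<T> N E \<longleftrightarrow> (\<forall>i\<in>{1..N}. soft_topology Z E (\<T> i))"

definition sub_soft_set :: "'e set \<Rightarrow> 'z set \<Rightarrow> ('e \<Rightarrow> 'z set) \<Rightarrow> 'e \<Rightarrow> 'z set" where
  "sub_soft_set E Y F = (\<lambda>e\<in>E. F e \<inter> Y)"

definition soft_relative_topology ::
    "'e set \<Rightarrow> 'z set \<Rightarrow> ('e \<Rightarrow> 'z set) set \<Rightarrow> ('e \<Rightarrow> 'z set) set" where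
  "soft_relative_topology E Y \<T> = {sub_soft_set E Y F | F. F \<in> \<T>}"

end

theory Submission
  imports Defs
begin

text \<open>Restriction to \<open>Y\<close> sends each soft set \<open>F\<close> to \<open>e \<mapsto> F e \<inter> Y\<close>, and the relative topology is
  the image of the original one under this map. Intersecting with a fixed set distributes over
  unions and over binary intersections, and for \<open>Y \<subseteq> X\<close> it sends \<open>\<emptyset>\<close> to \<open>\<emptyset>\<close> and \<open>X\<close> to \<open>Y\<close>; since
  soft operations are computed parameter by parameter, restriction commutes with all the
  operations in the definition of a soft topology. Each closure property therefore passes from a
  soft topology to its image. A soft \<open>N\<close>-topological space is a family of soft topologies, so the
  claim follows index by index.\<close>

lemma sub_soft_set_in_soft_sets: "sub_soft_set E Y F \<in> soft_sets Y E"
  by (auto simp: sub_soft_set_def soft_sets_def)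

lemma sub_soft_set_null: "sub_soft_set E Y (null_soft_set E) = null_soft_set E"
  by (auto simp: sub_soft_set_def null_soft_set_def intro!: restrict_ext)

lemma sub_soft_set_absolute:
  assumes "Y \<subseteq> X"
  shows "sub_soft_set E Y (absolute_soft_set X E) = absolute_soft_set Y E"
  using assms by (auto simp: sub_soft_set_def absolute_soft_set_def intro!: restrict_ext)

lemma sub_soft_set_inter:
  "sub_soft_set E Y (soft_inter E F G) = soft_inter E (sub_soft_set E Y F) (sub_soft_set E Y G)"
  by (auto simp: sub_soft_set_def soft_inter_def intro!: restrict_ext)

lemma sub_soft_set_Union:
  "sub_soft_set E Y (soft_Union E \<S>) = soft_Union E (sub_soft_set E Y ` \<S>)"
  by (auto simp: sub_soft_set_def soft_Union_def intro!: restrict_ext)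

lemma soft_relative_topology_eq_image:
  "soft_relative_topology E Y \<T> = sub_soft_set E Y ` \<T>"
  by (auto simp: soft_relative_topology_def)

lemma soft_topology_relative:
  assumes T: "soft_topology X E \<T>" and "Y \<subseteq> X"
  shows "soft_topology Y E (soft_relative_topology E Y \<T>)"
  unfolding soft_topology_def soft_relative_topology_eq_image
proof (intro conjI ballI allI impI)
  show "sub_soft_set E Y ` \<T> \<subseteq> soft_sets Y E"
    using sub_soft_set_in_soft_sets by blast
  have "null_soft_set E \<in> \<T>"
    using T by (simp add: soft_topology_def)
  then show "null_soft_set E \<in> sub_soft_set E Y ` \<T>"
    using sub_soft_set_null by (metis imageI)
  have "absolute_soft_set X E \<in> \<T>"
    using T by (simp add: soft_topology_def)
  then show "absolute_soft_set Y E \<in> sub_soft_set E Y ` \<T>"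
    using sub_soft_set_absolute[OF \<open>Y \<subseteq> X\<close>] by (metis imageI)
next
  fix F' G'
  assume "F' \<in> sub_soft_set E Y ` \<T>" "G' \<in> sub_soft_set E Y ` \<T>"
  then obtain F G where "F \<in> \<T>" "G \<in> \<T>"
    and eq: "F' = sub_soft_set E Y F" "G' = sub_soft_set E Y G"
    by blast
  then have "soft_inter E F G \<in> \<T>"
    using T by (simp add: soft_topology_def)
  then show "soft_inter E F' G' \<in> sub_soft_set E Y ` \<T>"
    unfolding eq sub_soft_set_inter[symmetric] by (rule imageI)
next
  fix \<S>'
  assume "\<S>' \<subseteq> sub_soft_set E Y ` \<T>"
  \<comment> \<open>Different soft sets may restrict to the same one; any family of preimages will do.\<close>
  then obtain \<S> where "\<S> \<subseteq> \<T>" and eq: "\<S>' = sub_soft_set E Y ` \<S>"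
    by (auto simp: subset_image_iff)
  then have "soft_Union E \<S> \<in> \<T>"
    using T by (simp add: soft_topology_def)
  then show "soft_Union E \<S>' \<in> sub_soft_set E Y ` \<T>"
    unfolding eq sub_soft_set_Union[symmetric] by (rule imageI)
qed

theorem proposition4p3:
  fixes X Y :: "'z set" and E :: "'e set" and N :: nat
    and \<T> :: "nat \<Rightarrow> ('e \<Rightarrow> 'z set) set"
  assumes "E \<noteq> {}"
    and "N \<ge> 1"
    and "soft_N_topological_space X \<T> N E"
    and "Y \<noteq> {}" and "Y \<subseteq> X"
  shows "soft_N_topological_space Y (\<lambda>i. soft_relative_topology E Y (\<T> i)) N E"
  using assms(3) soft_topology_relative[OF _ \<open>Y \<subseteq> X\<close>]
  unfolding soft_N_topological_space_def by blast

end
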